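(* Let $r$ be a power of the prime $p$, and consider a Desarguesian net of order $r$ and degree $m \ge 1$, with collinearity graph $\Gamma$. Let $L$ be a line of the net and $x$ a point not on $L$. Then the clique $\{x\} \cup (x^\perp \cap L)$ of $\Gamma$ is contained in a unique maximal clique $C_{x,L}$ of $\Gamma$. Moreover, when $p \nmid (m-1)$: if $\{x\} \cup (x^\perp \cap L)$ is not a maximal clique, then there is a unique line $M$ of the net passing through $x$ such that $C_{x,L} \subseteq L \cup M$.
   Context: A Desarguesian net of order $r$ and degree $m$ ($0\le m\le r+1$) is obtained from the Desarguesian affine plane of order $r$ by keeping $m$ parallel classes. Concretely: identify the point set with $\mathbb{F}_{r^2}$ (a 2-dimensional $\mathbb{F}_r$-vector space); fix a set $S\subseteq \mathbb{F}_{r^2}^*$ which is a union of $m$ cosets of $\mathbb{F}_r^*$ in $\mathbb{F}_{r^2}^*$ (the $m$ chosen directions). The lines of the net are the sets $a + d\,\mathbb{F}_r$ with $a \in \mathbb{F}_{r^2}$, $d \in S$. The collinearity graph $\Gamma$ has vertex set $\mathbb{F}_{r^2}$, two distinct vertices being adjacent iff their difference lies in $S$ (equivalently, iff they lie on a common line of the net). For a vertex $y$, $y^\perp$ denotes $\{y\}$ together with the set of neighbours of $y$. A clique is a set of pairwise adjacent vertices. *)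

theory Defs
  imports
    "HOL-Computational_Algebra.Primes"
    "HOL-Library.Cardinality"
    "HOL-Library.Ramsey"
begin

definition is_subfield :: "'a::field set \<Rightarrow> bool" where
  "is_subfield K \<longleftrightarrow>
     0 \<in> K \<and> 1 \<in> K \<and>
     (\<forall>x\<in>K. \<forall>y\<in>K. x + y \<in> K \<and> x * y \<in> K) \<and>
     (\<forall>x\<in>K. - x \<in> K \<and> inverse x \<in> K)"

text \<open>
  The points of the affine plane of order \<open>r\<close> are the elements of a finite field \<open>'a\<close> with
  \<open>r\<^sup>2\<close> elements, regarded as a plane over its subfield \<open>K\<close> with \<open>r\<close> elements. A parallel class
  is a coset \<open>d K\<^sup>*\<close> in the multiplicative group. There are \<open>r + 1\<close> such cosets,
  so \<open>m \<le> r + 1\<close> holds automatically in \<open>net_directions K m S\<close>.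
\<close>

definition unit_cosets :: "'a::field set \<Rightarrow> 'a set set" where
  "unit_cosets K = {(\<lambda>k. d * k) ` (K - {0}) | d. d \<noteq> 0}"

definition net_directions :: "'a::field set \<Rightarrow> nat \<Rightarrow> 'a set \<Rightarrow> bool" where
  "net_directions K m S \<longleftrightarrow>
     (\<exists>D. D \<subseteq> unit_cosets K \<and> finite D \<and> card D = m \<and> S = \<Union>D)"

definition net_lines :: "'a::field set \<Rightarrow> 'a set \<Rightarrow> 'a set set" where
  "net_lines K S = {(\<lambda>k. a + d * k) ` K | a d. d \<in> S}"

text \<open>
  The collinearity graph has vertex set \<open>UNIV\<close>; its edges are two-element sets, as expected by
  \<^const>\<open>clique\<close>. Since \<open>-1 \<in> K\<close>, a union \<open>S\<close> of cosets satisfies \<open>S = -S\<close>, so the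
  adjacency condition is symmetric.
\<close>

definition collinearity_edges :: "'a::field set \<Rightarrow> 'a set set" where
  "collinearity_edges S = {{x, y} | x y. x \<noteq> y \<and> x - y \<in> S}"

definition perp :: "'a set set \<Rightarrow> 'a \<Rightarrow> 'a set" where
  "perp E y = insert y {z. z \<noteq> y \<and> {y, z} \<in> E}"

definition maximal_clique :: "'a set \<Rightarrow> 'a set set \<Rightarrow> bool" where
  "maximal_clique C E \<longleftrightarrow> clique C E \<and> (\<forall>C'. clique C' E \<and> C \<subseteq> C' \<longrightarrow> C' = C)"

definition point_line_clique :: "'a set set \<Rightarrow> 'a \<Rightarrow> 'a set \<Rightarrow> 'a set" where
  "point_line_clique E x L = insert x (perp E x \<inter> L)"

end

theory Submission
  imports Defs
begin

text \<open>
  Choose coordinates such that \<open>x\<close> is the origin and \<open>L\<close> is the line \<open>v = 1\<close>, and let \<open>T\<close> be the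
  set of slopes \<open>t\<close> such that the direction of \<open>(t, 1)\<close> belongs to the net, so that
  \<open>x\<^sup>\<bottom> \<inter> L = {(t, 1) | t \<in> T}\<close>. A point \<open>(u, v)\<close> off \<open>L\<close> that is adjacent to all of these points
  gives an affine permutation \<open>t \<mapsto> (t - u) / (1 - v)\<close> of \<open>T\<close>, which is a translation if \<open>v = 0\<close>
  and otherwise has the fixed point \<open>u / v\<close>; this fixed point is in \<open>T\<close> by adjacency to \<open>x\<close>.
  Two such points are adjacent iff the quotient of their affine maps is a translation or has its
  fixed point in \<open>T\<close>. The multiplier \<open>c\<close> of an affine permutation of \<open>T\<close> satisfies
  \<open>c ^ (|T| - 1) = 1\<close> if the fixed point is in \<open>T\<close> and \<open>c ^ |T| = 1\<close> otherwise. The quotient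
  inherits the first equation, so for \<open>c \<noteq> 1\<close> its fixed point is in \<open>T\<close>. Hence the common
  neighbours form a clique. If \<open>p\<close> does not divide \<open>|T| = m - 1\<close>, then there are no nontrivial
  translations, and all affine permutations of \<open>T\<close> fix the centroid of \<open>T\<close>, which is the slope
  of \<open>M\<close>.
\<close>

section \<open>Affine maps preserving a finite set\<close>

text \<open>Multiplication by \<open>c\<close> permutes the finite set \<open>A\<close>, so it
  leaves \<open>\<Prod>A\<close> unchanged; cancelling this nonzero product gives the
  equation.\<close>

lemma power_card_eq_1_if_mult_closed:
  fixes c :: "'a::field"
  assumes "finite A" "0 \<notin> A" "c \<noteq> 0" "\<And>t. t \<in> A \<Longrightarrow> c * t \<in> A"
  shows "c ^ card A = 1"
proof -
  have inj: "inj_on ((*) c) A"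
    using assms(3) by (auto intro: inj_onI)
  then have "(*) c ` A = A"
    using assms(1,4) by (intro card_subset_eq) (auto simp: card_image)
  then have "\<Prod>A = (\<Prod>t\<in>A. c * t)"
    using prod.reindex[OF inj, of "\<lambda>t. t"] by simp
  also have "\<dots> = c ^ card A * \<Prod>A"
    by (simp add: prod.distrib)
  finally show ?thesis
    using assms(1,2) by simp
qed

text \<open>Moving the centre \<open>s\<close> to the origin turns the map into multiplication by
  \<open>c\<close>. The exponent is \<open>card T - 1\<close> or \<open>card T\<close> according to
  whether \<open>s\<close> lies in \<open>T\<close>; comparing the two cases is what later forces a
  centre into \<open>T\<close>.\<close>

lemma homothety_power_card_eq_1:
  fixes c s :: "'a::field"
  assumes "finite T" "c \<noteq> 0" "\<And>t. t \<in> T \<Longrightarrow> c * (t - s) + s \<in> T"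
  shows "c ^ card (T - {s}) = 1"
proof -
  let ?A = "(\<lambda>t. t - s) ` (T - {s})"
  have "c * t \<in> ?A" if "t \<in> ?A" for t
  proof -
    from that obtain t' where "t' \<in> T" "t' \<noteq> s" "t = t' - s" by auto
    then show ?thesis
      using assms(2,3) by (intro image_eqI[of _ _ "c * (t' - s) + s"]) auto
  qed
  then have "c ^ card ?A = 1"
    using assms(1,2) by (intro power_card_eq_1_if_mult_closed) auto
  also have "card ?A = card (T - {s})"
    by (intro card_image) (auto intro: inj_onI)
  finally show ?thesis .
qed

text \<open>The map permutes \<open>T\<close>, so summing its values gives \<open>\<Sum>T\<close>
  again. This is the algebraic form of the statement that the centroid is fixed.\<close>

lemma sum_affine_eq:
  fixes c b :: "'a::field"
  assumes "finite T" "c \<noteq> 0" "\<And>t. t \<in> T \<Longrightarrow> c * t + b \<in> T"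
  shows "\<Sum>T = c * \<Sum>T + of_nat (card T) * b"
proof -
  have inj: "inj_on (\<lambda>t. c * t + b) T"
    using assms(2) by (auto intro: inj_onI)
  then have "(\<lambda>t. c * t + b) ` T = T"
    using assms(1,3) by (intro card_subset_eq) (auto simp: card_image)
  then have "\<Sum>T = (\<Sum>t\<in>T. c * t + b)"
    using sum.reindex[OF inj, of "\<lambda>t. t"] by simp
  also have "\<dots> = c * \<Sum>T + of_nat (card T) * b"
    by (simp add: sum.distrib sum_distrib_left)
  finally show ?thesis .
qed

lemma of_nat_eq_0_imp_prime_dvd:
  assumes "prime p" "CARD('a::{field, finite}) = p ^ k" "of_nat j = (0 :: 'a)"
  shows "p dvd j"
proof (rule ccontr)
  assume "\<not> p dvd j"
  \<comment> \<open>Translation by 1 permutes the whole field, so the sum of all elements equals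
    itself plus \<open>CARD('a)\<close>.\<close>
  have "of_nat CARD('a) = (0 :: 'a)"
    using sum_affine_eq[of "UNIV :: 'a set" 1 1] by simp
  then have p: "of_nat p = (0 :: 'a)"
    using assms(2) by simp
  have "coprime p j"
    using assms(1) \<open>\<not> p dvd j\<close> by (simp add: prime_imp_coprime)
  then obtain a b where "a * int p + b * int j = 1"
    by (metis bezout_int coprime_int_iff coprime_imp_gcd_eq_1)
  then have "of_int (a * int p + b * int j) = (1 :: 'a)"
    by simp
  then show False
    using p assms(3) by simp
qed

section \<open>Directions and the collinearity graph\<close>

lemma is_subfieldD:
  assumes "is_subfield K"
  shows "0 \<in> K" "1 \<in> K"
    and "\<And>a b. a \<in> K \<Longrightarrow> b \<in> K \<Longrightarrow> a + b \<in> K"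
    and "\<And>a b. a \<in> K \<Longrightarrow> b \<in> K \<Longrightarrow> a * b \<in> K"
    and "\<And>a. a \<in> K \<Longrightarrow> - a \<in> K"
    and "\<And>a. a \<in> K \<Longrightarrow> inverse a \<in> K"
    and "\<And>a b. a \<in> K \<Longrightarrow> b \<in> K \<Longrightarrow> a - b \<in> K"
    and "\<And>a b. a \<in> K \<Longrightarrow> b \<in> K \<Longrightarrow> a / b \<in> K"
proof -
  show add: "\<And>a b. a \<in> K \<Longrightarrow> b \<in> K \<Longrightarrow> a + b \<in> K"
    and mult: "\<And>a b. a \<in> K \<Longrightarrow> b \<in> K \<Longrightarrow> a * b \<in> K"
    and uminus: "\<And>a. a \<in> K \<Longrightarrow> - a \<in> K"
    and inverse: "\<And>a. a \<in> K \<Longrightarrow> inverse a \<in> K"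
    and "0 \<in> K" "1 \<in> K"
    using assms by (auto simp: is_subfield_def)
  show "a - b \<in> K" if "a \<in> K" "b \<in> K" for a b
    using add[OF that(1) uminus[OF that(2)]] by simp
  show "a / b \<in> K" if "a \<in> K" "b \<in> K" for a b
    using mult[OF that(1) inverse[OF that(2)]] by (simp add: divide_inverse)
qed

lemma unit_coset_eqI:
  assumes "is_subfield K" "k \<in> K" "k \<noteq> 0" "d = f * k"
  shows "(\<lambda>k. d * k) ` (K - {0}) = (\<lambda>k. f * k) ` (K - {0})"
proof (intro subset_antisym subsetI)
  fix z assume "z \<in> (\<lambda>k. d * k) ` (K - {0})"
  then obtain l where "l \<in> K" "l \<noteq> 0" "z = f * (k * l)"
    using assms(4) by (auto simp: mult.assoc)
  then show "z \<in> (\<lambda>k. f * k) ` (K - {0})"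
    using assms(2,3) is_subfieldD(4)[OF assms(1)] by (intro image_eqI[of _ _ "k * l"]) auto
next
  fix z assume "z \<in> (\<lambda>k. f * k) ` (K - {0})"
  then obtain l where "l \<in> K" "l \<noteq> 0" "z = f * l" by auto
  moreover from this have "z = d * (l / k)"
    using assms(3,4) by simp
  ultimately show "z \<in> (\<lambda>k. d * k) ` (K - {0})"
    using assms(2,3) is_subfieldD(8)[OF assms(1)] by (intro image_eqI[of _ _ "l / k"]) auto
qed

lemma Union_unit_cosets_memD:
  assumes "is_subfield K" "D \<subseteq> unit_cosets K" "f \<in> \<Union>D"
  shows "f \<noteq> 0" "(\<lambda>k. f * k) ` (K - {0}) \<in> D"
proof -
  obtain g where g: "g \<noteq> 0" "(\<lambda>k. g * k) ` (K - {0}) \<in> D" "f \<in> (\<lambda>k. g * k) ` (K - {0})"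
    using assms(2,3) unfolding unit_cosets_def by blast
  then obtain k where "k \<in> K" "k \<noteq> 0" "f = g * k" by auto
  then show "f \<noteq> 0" "(\<lambda>k. f * k) ` (K - {0}) \<in> D"
    using g unit_coset_eqI[OF assms(1), of k f g] by auto
qed

text \<open>Moving the base point to \<open>x\<close> and rescaling the direction to
  \<open>z - x\<close> reparametrizes the line by an affine bijection of \<open>K\<close>. Hence two
  distinct points determine a line, which yields the uniqueness of \<open>M\<close>.\<close>

lemma net_line_eq_through:
  assumes "is_subfield K" "M \<in> net_lines K S" "x \<in> M" "z \<in> M" "z \<noteq> x"
  shows "M = (\<lambda>k. x + (z - x) * k) ` K"
proof -
  note K = is_subfieldD[OF assms(1)]
  obtain a f where M: "M = (\<lambda>k. a + f * k) ` K"
    using assms(2) by (auto simp: net_lines_def)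
  obtain i j where ij: "i \<in> K" "x = a + f * i" "j \<in> K" "z = a + f * j"
    using assms(3,4) M by auto
  then have zx: "z - x = f * (j - i)" and ne: "j - i \<noteq> 0"
    using assms(5) by (auto simp: algebra_simps)
  show ?thesis
  proof (intro subset_antisym subsetI)
    fix w assume "w \<in> M"
    then obtain k where "k \<in> K" "w = a + f * k" using M by auto
    moreover have "(z - x) * ((k - i) / (j - i)) = f * (k - i)"
      using ne by (simp add: zx)
    ultimately have "k \<in> K" "w = x + (z - x) * ((k - i) / (j - i))"
      using ij(2) by (simp_all add: algebra_simps)
    then show "w \<in> (\<lambda>k. x + (z - x) * k) ` K"
      using K(7,8) ij(1,3) by (intro image_eqI[of _ _ "(k - i) / (j - i)"]) auto
  next
    fix w assume "w \<in> (\<lambda>k. x + (z - x) * k) ` K"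
    then obtain k where "k \<in> K" "w = x + (z - x) * k" by auto
    moreover from this have "w = a + f * (i + (j - i) * k)"
      unfolding zx by (simp add: ij(2) algebra_simps)
    ultimately show "w \<in> M"
      unfolding M using K(3,4,7) ij(1,3) by (intro image_eqI[of _ _ "i + (j - i) * k"]) auto
  qed
qed

section \<open>Coordinates adapted to a point and a line\<close>

text \<open>Here \<open>d\<close> is the direction of \<open>L\<close>, and \<open>e\<close> leads
  from \<open>x\<close> to a point of \<open>L\<close>; thus \<open>L\<close> consists of the points
  \<open>pt k 1\<close> with \<open>k \<in> K\<close>.\<close>

locale net_frame =
  fixes K S :: "'a::{field, finite} set" and x d e :: 'a
  assumes subfield: "is_subfield K"
    and S_scale: "\<And>f k. f \<in> S \<Longrightarrow> k \<in> K \<Longrightarrow> k \<noteq> 0 \<Longrightarrow> k * f \<in> S"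
    and zero_notin_S: "0 \<notin> S"
    and d_in_S: "d \<in> S"
    and independent: "\<And>u v. u \<in> K \<Longrightarrow> v \<in> K \<Longrightarrow> u * d + v * e = 0 \<Longrightarrow> u = 0 \<and> v = 0"
    and spanning: "\<And>z. \<exists>u\<in>K. \<exists>v\<in>K. z = u * d + v * e"
begin

lemmas K_closed = is_subfieldD[OF subfield]

definition pt :: "'a \<Rightarrow> 'a \<Rightarrow> 'a" where
  "pt u v = x + (u * d + v * e)"

definition slopes :: "'a set" where
  "slopes = {t \<in> K. t * d + e \<in> S}"

text \<open>Equality is included so that cliques are the sets on which \<open>adj\<close> holds for
  all pairs.\<close>

definition adj :: "'a \<Rightarrow> 'a \<Rightarrow> bool" where
  "adj z w \<longleftrightarrow> z = w \<or> z - w \<in> S"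

definition base :: "'a set" where
  "base = insert x ((\<lambda>t. pt t 1) ` slopes)"

text \<open>Any clique containing \<open>base\<close> lies in this set, so it is the unique maximal
  one as soon as it is itself a clique.\<close>

definition hull :: "'a set" where
  "hull = {z. \<forall>q\<in>base. adj z q}"

lemma S_uminus: "- f \<in> S \<longleftrightarrow> f \<in> S"
proof -
  have "- f \<in> S" if "f \<in> S" for f
    using S_scale[OF that, of "-1"] K_closed(2) K_closed(5)[of 1] by simp
  from this[of f] this[of "- f"] show ?thesis by auto
qed

lemma adj_sym: "adj z w \<longleftrightarrow> adj w z"
  using S_uminus[of "z - w"] by (auto simp: adj_def)

lemma edge_iff: "{z, w} \<in> collinearity_edges S \<longleftrightarrow> z \<noteq> w \<and> adj z w"
proof -
  have "w - z \<in> S \<longleftrightarrow> z - w \<in> S"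
    using S_uminus[of "z - w"] by simp
  then show ?thesis
    unfolding collinearity_edges_def adj_def by (auto simp: doubleton_eq_iff)
qed

lemma clique_iff: "clique C (collinearity_edges S) \<longleftrightarrow> (\<forall>z\<in>C. \<forall>w\<in>C. adj z w)"
  by (auto simp: clique_def edge_iff) (auto simp: adj_def)

lemma pt_cases:
  obtains u v where "u \<in> K" "v \<in> K" "z = pt u v"
proof -
  obtain u v where "u \<in> K" "v \<in> K" "z - x = u * d + v * e"
    using spanning by blast
  then show ?thesis
    by (intro that[of u v]) (auto simp: pt_def algebra_simps)
qed

lemma pt_0: "pt 0 0 = x"
  by (simp add: pt_def)

lemma pt_eq_iff:
  assumes "u \<in> K" "v \<in> K" "u' \<in> K" "v' \<in> K"
  shows "pt u v = pt u' v' \<longleftrightarrow> u = u' \<and> v = v'"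
proof -
  have "pt u v = pt u' v' \<longleftrightarrow> (u - u') * d + (v - v') * e = 0"
    unfolding pt_def by algebra
  then show ?thesis
    using independent[of "u - u'" "v - v'"] assms K_closed(7) by auto
qed

text \<open>For \<open>v \<noteq> 0\<close> the vector is \<open>v\<close> times the vector of slope
  \<open>u / v\<close>, and \<open>S\<close> is closed under nonzero scalars. For
  \<open>v = 0\<close> it is a multiple of \<open>d\<close>, hence zero or in
  \<open>S\<close>.\<close>

lemma direction_in_S_iff:
  assumes "u \<in> K" "v \<in> K"
  shows "u * d + v * e = 0 \<or> u * d + v * e \<in> S \<longleftrightarrow> v = 0 \<or> u / v \<in> slopes"
proof (cases "v = 0")
  case True
  then show ?thesis using S_scale[OF d_in_S assms(1)] by auto
next
  case False
  have eq: "u * d + v * e = v * (u / v * d + e)"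
    using False by (simp add: algebra_simps)
  have "u * d + v * e \<in> S \<longleftrightarrow> u / v * d + e \<in> S"
  proof
    assume "u * d + v * e \<in> S"
    then have "inverse v * (u * d + v * e) \<in> S"
      using False assms K_closed(6) by (intro S_scale) auto
    also have "inverse v * (u * d + v * e) = u / v * d + e"
      using False unfolding eq mult.assoc[symmetric] by simp
    finally show "u / v * d + e \<in> S" .
  next
    assume "u / v * d + e \<in> S"
    then show "u * d + v * e \<in> S"
      unfolding eq using False assms by (intro S_scale)
  qed
  then show ?thesis
    using False independent[of u v] assms K_closed(8) by (auto simp: slopes_def)
qed

lemma adj_pt_iff:
  assumes "u \<in> K" "v \<in> K" "u' \<in> K" "v' \<in> K"
  shows "adj (pt u v) (pt u' v') \<longleftrightarrow> v = v' \<or> (u - u') / (v - v') \<in> slopes"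
proof -
  have *: "pt u v - pt u' v' = (u - u') * d + (v - v') * e"
    by (simp add: pt_def algebra_simps)
  then have "adj (pt u v) (pt u' v') \<longleftrightarrow>
      (u - u') * d + (v - v') * e = 0 \<or> (u - u') * d + (v - v') * e \<in> S"
    unfolding adj_def by (metis eq_iff_diff_eq_0)
  then show ?thesis
    using direction_in_S_iff[of "u - u'" "v - v'"] assms K_closed(7) by simp
qed

lemma slopes_in_K: "t \<in> slopes \<Longrightarrow> t \<in> K"
  by (simp add: slopes_def)

section \<open>The common neighbours form the unique maximal clique\<close>

text \<open>The first conjunct is adjacency to \<open>x\<close>. In the second,
  \<open>(t - u) / (1 - v)\<close> is the slope of the line joining the point to
  \<open>pt t 1\<close>.\<close>

lemma pt_in_hull_iff:
  assumes "u \<in> K" "v \<in> K"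
  shows "pt u v \<in> hull \<longleftrightarrow>
    (v = 0 \<or> u / v \<in> slopes) \<and> (\<forall>t\<in>slopes. v = 1 \<or> (t - u) / (1 - v) \<in> slopes)"
proof -
  have "(u - t) / (v - 1) = (t - u) / (1 - v)" for t
    by (metis minus_diff_eq minus_divide_divide)
  then show ?thesis
    using adj_pt_iff[OF assms, of 0 0] adj_pt_iff[OF assms, of _ 1] assms K_closed(1,2)
    by (auto simp: hull_def base_def pt_0 slopes_in_K)
qed

lemma line_Int_hull: "(\<lambda>k. pt k 1) ` K \<inter> hull \<subseteq> base"
  using pt_in_hull_iff[of _ 1] K_closed(2) by (auto simp: base_def)

lemma homothety_form:
  fixes u v t :: 'a
  assumes "v \<noteq> 0" "v \<noteq> 1"
  shows "(t - u) / (1 - v) = 1 / (1 - v) * (t - u / v) + u / v"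
proof -
  have "(1 / (1 - v) * (t - u / v) + u / v) * (1 - v) = t - u / v + u / v * (1 - v)"
    using assms(2) by (simp add: distrib_right)
  also have "\<dots> = t - u"
    using assms(1) by (simp add: right_diff_distrib)
  finally show ?thesis
    using assms(2) by (simp add: divide_eq_eq)
qed

text \<open>For \<open>v = 0\<close> the multiplier is 1. Otherwise the centre \<open>u / v\<close>
  is a slope by adjacency to \<open>x\<close>, which reduces the exponent to
  \<open>card slopes - 1\<close>.\<close>

lemma hull_multiplier:
  assumes "u \<in> K" "v \<in> K" "v \<noteq> 1" "pt u v \<in> hull"
  shows "(1 / (1 - v)) ^ (card slopes - 1) = 1"
proof (cases "v = 0")
  case False
  then have uv: "u / v \<in> slopes" and g: "\<And>t. t \<in> slopes \<Longrightarrow> (t - u) / (1 - v) \<in> slopes"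
    using assms by (auto simp: pt_in_hull_iff)
  have "(1 / (1 - v)) ^ card (slopes - {u / v}) = 1"
    using assms(3) g unfolding homothety_form[OF False assms(3)]
    by (intro homothety_power_card_eq_1) auto
  then show ?thesis
    using uv by simp
qed simp

lemma hull_adj_off_line:
  assumes K: "u \<in> K" "v \<in> K" "u' \<in> K" "v' \<in> K"
    and hull: "pt u v \<in> hull" "pt u' v' \<in> hull"
    and ne: "v \<noteq> 1" "v' \<noteq> 1" "v \<noteq> v'"
  shows "adj (pt u v) (pt u' v')"
proof -
  \<comment> \<open>Inverting the affine map of the second point and then applying that of the first
    is a homothety with ratio \<open>c\<close> and centre \<open>s\<close>. Its centre is also the
    slope of the line joining the two points, so it remains to show
    \<open>s \<in> slopes\<close>.\<close>
  define c where "c = (1 - v') / (1 - v)"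
  define s where "s = (u - u') / (v - v')"
  have c: "c \<noteq> 0" "c \<noteq> 1"
    using ne by (auto simp: c_def)
  have g: "(t - u) / (1 - v) \<in> slopes" "(t - u') / (1 - v') \<in> slopes" if "t \<in> slopes" for t
    using that assms by (auto simp: pt_in_hull_iff)
  have "inj_on (\<lambda>t. (t - u') / (1 - v')) slopes"
    using ne(2) by (auto intro: inj_onI)
  then have onto: "(\<lambda>t. (t - u') / (1 - v')) ` slopes = slopes"
    using g(2) by (intro card_subset_eq) (auto simp: card_image)
  have "c * (t - s) + s \<in> slopes" if "t \<in> slopes" for t
  proof -
    from that onto obtain t' where t': "t' \<in> slopes" "t = (t' - u') / (1 - v')"
      by auto
    have s: "s * (v - v') = u - u'"
      using ne(3) by (simp add: s_def)
    have "(1 - v) * (c * (t - s) + s) = (1 - v') * (t - s) + (1 - v) * s"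
      using ne(1) by (simp add: c_def field_simps)
    also have "\<dots> = (1 - v') * t - s * (v - v')"
      by (simp add: algebra_simps)
    also have "\<dots> = t' - u"
      using ne(2) by (simp add: s t'(2))
    finally have "c * (t - s) + s = (t' - u) / (1 - v)"
      using ne(1) by (simp add: field_simps)
    then show ?thesis
      using g(1)[OF t'(1)] by simp
  qed
  then have pow: "c ^ card (slopes - {s}) = 1"
    using c by (intro homothety_power_card_eq_1) auto
  have "c = (1 / (1 - v)) / (1 / (1 - v'))"
    by (simp add: c_def)
  then have pow': "c ^ (card slopes - 1) = 1"
    using hull_multiplier K hull ne by (simp only: power_divide div_self) simp
  \<comment> \<open>One of \<open>v\<close>, \<open>v'\<close> is nonzero and so provides a slope;
    therefore the subtraction in \<open>card slopes - 1\<close> is not truncated.\<close>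
  have "slopes \<noteq> {}"
    using pt_in_hull_iff[OF K(1,2)] pt_in_hull_iff[OF K(3,4)] hull ne(3) by auto
  then have card: "card slopes = Suc (card slopes - 1)"
    by (simp add: card_gt_0_iff)
  \<comment> \<open>Otherwise two consecutive powers of \<open>c\<close> would be 1, forcing
    \<open>c = 1\<close>.\<close>
  have "s \<in> slopes"
  proof (rule ccontr)
    assume "s \<notin> slopes"
    then have "c ^ Suc (card slopes - 1) = 1"
      using pow card by simp
    then show False
      using pow' c(2) by simp
  qed
  then show ?thesis
    using K by (simp add: adj_pt_iff s_def)
qed

text \<open>Besides the case of distinct heights off \<open>L\<close>, a point on \<open>L\<close>
  already belongs to \<open>base\<close>, and points of equal height differ by a multiple of
  \<open>d\<close>.\<close>

lemma hull_adj:
  assumes "z \<in> hull" "w \<in> hull"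
  shows "adj z w"
proof -
  obtain u v where z: "u \<in> K" "v \<in> K" "z = pt u v" by (rule pt_cases)
  obtain u' v' where w: "u' \<in> K" "v' \<in> K" "w = pt u' v'" by (rule pt_cases)
  consider "v = 1" | "v' = 1" | "v = v'" | "v \<noteq> 1" "v' \<noteq> 1" "v \<noteq> v'" by blast
  then show ?thesis
  proof cases
    case 1
    then have "z \<in> base" using z assms(1) line_Int_hull by auto
    then show ?thesis using assms(2) adj_sym by (auto simp: hull_def)
  next
    case 2
    then have "w \<in> base" using w assms(2) line_Int_hull by auto
    then show ?thesis using assms(1) by (auto simp: hull_def)
  next
    case 3
    then show ?thesis using z w by (simp add: adj_pt_iff)
  next
    case 4
    then show ?thesis using z w assms by (simp add: hull_adj_off_line)
  qed
qed

lemma base_adj: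
  assumes "z \<in> base" "w \<in> base"
  shows "adj z w"
proof -
  have "adj x (pt t 1)" if "t \<in> slopes" for t
    using adj_pt_iff[of 0 0 t 1] that slopes_in_K K_closed(1,2) by (simp add: pt_0)
  moreover have "adj (pt t 1) (pt t' 1)" if "t \<in> slopes" "t' \<in> slopes" for t t'
    using adj_pt_iff[of t 1 t' 1] that slopes_in_K K_closed(2) by simp
  moreover have "adj x x" by (simp add: adj_def)
  ultimately show ?thesis
    using assms adj_sym unfolding base_def by blast
qed

lemma base_subset_hull: "base \<subseteq> hull"
  using base_adj by (auto simp: hull_def)

lemma clique_base: "clique base (collinearity_edges S)"
  using base_adj by (simp add: clique_iff)

lemma maximal_clique_hull: "maximal_clique hull (collinearity_edges S)"
  unfolding maximal_clique_def clique_iff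
proof (intro conjI allI impI ballI)
  fix C' assume C': "(\<forall>z\<in>C'. \<forall>w\<in>C'. adj z w) \<and> hull \<subseteq> C'"
  then have "C' \<subseteq> hull"
    using base_subset_hull by (auto simp: hull_def subset_iff)
  then show "C' = hull"
    using C' by blast
qed (rule hull_adj)

lemma maximal_clique_eq_hull:
  assumes "maximal_clique C (collinearity_edges S)" "base \<subseteq> C"
  shows "C = hull"
proof -
  have "C \<subseteq> hull"
    using assms by (auto simp: maximal_clique_def clique_iff hull_def)
  then show ?thesis
    using assms(1) maximal_clique_hull by (auto simp: maximal_clique_def)
qed

lemma point_line_clique_eq_base:
  "point_line_clique (collinearity_edges S) x ((\<lambda>k. pt k 1) ` K) = base"
proof -
  have "adj x (pt k 1) \<longleftrightarrow> k \<in> slopes" "pt k 1 \<noteq> x" if "k \<in> K" for k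
    using that adj_pt_iff[of 0 0 k 1] pt_eq_iff[of k 1 0 0] K_closed(1,2)
    by (auto simp: pt_0)
  then show ?thesis
    unfolding point_line_clique_def base_def perp_def
    by (auto simp: edge_iff slopes_in_K)
qed

section \<open>The line covering the rest of the maximal clique\<close>

text \<open>Summing the affine permutation over \<open>slopes\<close> gives
  \<open>v * \<Sum>slopes = n * u\<close>, where \<open>n\<close> is the number of slopes. As
  \<open>n\<close> is invertible, \<open>v = 0\<close> would force \<open>u = 0\<close>, that is,
  the point \<open>x\<close>.\<close>

lemma hull_slope_eq_centroid:
  assumes "of_nat (card slopes) \<noteq> (0 :: 'a)"
    and "u \<in> K" "v \<in> K" "v \<noteq> 1" "pt u v \<in> hull" "pt u v \<noteq> x"
  shows "v \<noteq> 0" "u / v = \<Sum>slopes / of_nat (card slopes)"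
proof -
  let ?n = "of_nat (card slopes) :: 'a"
  have g: "(t - u) / (1 - v) \<in> slopes" if "t \<in> slopes" for t
    using that assms by (auto simp: pt_in_hull_iff)
  have eq: "(t - u) / (1 - v) = 1 / (1 - v) * t + - u / (1 - v)" for t
    by (simp add: diff_divide_distrib)
  have "\<Sum>slopes = 1 / (1 - v) * \<Sum>slopes + ?n * (- u / (1 - v))"
    using g assms(4) by (intro sum_affine_eq) (auto simp: eq)
  then have "(1 - v) * \<Sum>slopes = \<Sum>slopes - ?n * u"
    using assms(4) by (simp add: diff_divide_distrib[symmetric] eq_divide_eq mult.commute)
  then have *: "v * \<Sum>slopes = ?n * u"
    by (simp add: algebra_simps)
  show "v \<noteq> 0"
    using * assms(1,6) by (auto simp: pt_0)
  then show "u / v = \<Sum>slopes / ?n"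
    using * assms(1) by (simp add: field_simps)
qed

lemma unique_line_covering_hull:
  assumes n: "of_nat (card slopes) \<noteq> (0 :: 'a)"
    and not_max: "\<not> maximal_clique base (collinearity_edges S)"
  shows "\<exists>!M. M \<in> net_lines K S \<and> x \<in> M \<and> hull \<subseteq> (\<lambda>k. pt k 1) ` K \<union> M"
proof -
  let ?L = "(\<lambda>k. pt k 1) ` K"
  define s where "s = \<Sum>slopes / of_nat (card slopes)"
  define M where "M = (\<lambda>k. x + (s * d + e) * k) ` K"
  \<comment> \<open>This point serves twice: it shows that the centroid \<open>s\<close> is itself a
    slope, so that \<open>M\<close> is a line of the net, and together with \<open>x\<close> it
    determines \<open>M\<close>, since it lies off \<open>L\<close>.\<close>
  obtain z where z: "z \<in> hull" "z \<notin> base"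
    using not_max maximal_clique_hull base_subset_hull by (metis subsetI subset_antisym)
  then have zL: "z \<notin> ?L" and zx: "z \<noteq> x"
    using line_Int_hull by (auto simp: base_def)
  obtain u v where uv: "u \<in> K" "v \<in> K" "z = pt u v" by (rule pt_cases)
  have "v \<noteq> 1"
    using zL uv by auto
  then have "v \<noteq> 0" "u / v = s"
    using hull_slope_eq_centroid[OF n uv(1,2)] z(1) zx uv(3) by (auto simp: s_def)
  then have "s \<in> slopes"
    using z(1) uv pt_in_hull_iff by auto
  then have "M \<in> net_lines K S"
    unfolding M_def net_lines_def slopes_def by blast
  moreover have "x \<in> M"
    unfolding M_def using K_closed(1) by (intro image_eqI[of _ _ 0]) auto
  moreover have sub: "hull \<subseteq> ?L \<union> M"
  proof
    fix w assume w: "w \<in> hull"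
    obtain u v where uv: "u \<in> K" "v \<in> K" "w = pt u v" by (rule pt_cases)
    consider "w = x" | "v = 1" | "v \<noteq> 1" "w \<noteq> x" by blast
    then show "w \<in> ?L \<union> M"
    proof cases
      case 3
      then have "v \<noteq> 0" "u / v = s"
        using hull_slope_eq_centroid[OF n uv(1,2)] w uv(3) by (auto simp: s_def)
      then have "w = x + (s * d + e) * v"
        unfolding uv(3) pt_def by (auto simp: field_simps)
      then show ?thesis using uv(2) by (auto simp: M_def)
    qed (use uv \<open>x \<in> M\<close> in auto)
  qed
  moreover have "M' = M"
    if "M' \<in> net_lines K S \<and> x \<in> M' \<and> hull \<subseteq> ?L \<union> M'" for M'
  proof -
    have "z \<in> M'" "z \<in> M"
      using that sub z(1) zL by auto
    then show ?thesis
      using that \<open>M \<in> net_lines K S\<close> \<open>x \<in> M\<close> zx net_line_eq_through[OF subfield, of _ S x z]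
      by metis
  qed
  ultimately show ?thesis by blast
qed

text \<open>The coset \<open>d K\<^sup>*\<close> is the direction of \<open>L\<close>, the only one without a slope.\<close>

lemma card_slopes:
  assumes "D \<subseteq> unit_cosets K" "finite D" "S = \<Union>D"
  shows "card slopes = card D - 1"
proof -
  define coset where "coset f = (\<lambda>k. f * k) ` (K - {0})" for f
  have mem: "f \<in> coset f" for f
    unfolding coset_def using K_closed(2) by (intro image_eqI[of _ _ 1]) auto
  have coset_D: "f \<noteq> 0" "coset f \<in> D" if "f \<in> S" for f
    using Union_unit_cosets_memD[OF subfield assms(1)] that assms(3) by (auto simp: coset_def)
  \<comment> \<open>Proportional vectors with the same coefficient 1 at \<open>e\<close> are
    equal.\<close>
  have inj: "inj_on (\<lambda>t. coset (t * d + e)) slopes"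
  proof (rule inj_onI)
    fix t t' assume t: "t \<in> slopes" "t' \<in> slopes" "coset (t * d + e) = coset (t' * d + e)"
    then obtain k where k: "k \<in> K" "t * d + e = (t' * d + e) * k"
      using mem[of "t * d + e"] by (auto simp: coset_def)
    then have "(t - t' * k) * d + (1 - k) * e = 0"
      by (simp add: algebra_simps)
    then have "t - t' * k = 0 \<and> 1 - k = 0"
      using t k slopes_in_K K_closed by (intro independent) auto
    then show "t = t'" by auto
  qed
  have "(\<lambda>t. coset (t * d + e)) ` slopes = D - {coset d}"
  proof (intro subset_antisym subsetI)
    fix c assume "c \<in> (\<lambda>t. coset (t * d + e)) ` slopes"
    then obtain t where t: "t \<in> K" "t * d + e \<in> S" "c = coset (t * d + e)"
      by (auto simp: slopes_def)
    have "c \<noteq> coset d"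
    proof
      assume "c = coset d"
      then obtain k where k: "k \<in> K" "t * d + e = d * k"
        using mem[of "t * d + e"] t(3) by (auto simp: coset_def)
      then have "(t - k) * d + 1 * e = 0" by (simp add: algebra_simps)
      then have "t - k = 0 \<and> (1 :: 'a) = 0"
        using t k K_closed by (intro independent) auto
      then show False by simp
    qed
    then show "c \<in> D - {coset d}"
      using t coset_D(2) by auto
  next
    fix c assume c: "c \<in> D - {coset d}"
    then obtain f where f: "f \<noteq> 0" "c = coset f"
      using assms(1) unfolding unit_cosets_def coset_def by blast
    then have fS: "f \<in> S"
      using mem[of f] c assms(3) by auto
    obtain u v where uv: "u \<in> K" "v \<in> K" "f = u * d + v * e"
      using spanning by blast
    \<comment> \<open>A coset other than \<open>coset d\<close> has nonzero
      \<open>e\<close>-coordinate \<open>v\<close>; dividing by \<open>v\<close> gives the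
      representative that exhibits its slope.\<close>
    have "v \<noteq> 0"
    proof
      assume "v = 0"
      then have "f = d * u" "u \<noteq> 0" using uv f by auto
      then have "coset f = coset d"
        unfolding coset_def using uv(1) by (intro unit_coset_eqI[OF subfield, of u])
      then show False using c f by simp
    qed
    then have "u / v \<in> slopes" "f = (u / v * d + e) * v"
      using direction_in_S_iff[OF uv(1,2)] fS uv(3) by (auto simp: field_simps)
    moreover from this have "c = coset (u / v * d + e)"
      unfolding f(2) coset_def using uv(2) \<open>v \<noteq> 0\<close>
      by (intro unit_coset_eqI[OF subfield, of v])
    ultimately show "c \<in> (\<lambda>t. coset (t * d + e)) ` slopes" by blast
  qed
  then have "card slopes = card (D - {coset d})"
    using card_image[OF inj] by simp
  then show ?thesis
    using coset_D(2)[OF d_in_S] assms(2) by simp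
qed

end

section \<open>Frames from a point off a line, and the theorem\<close>

lemma net_frameI:
  fixes K S :: "'a::{field, finite} set"
  assumes "is_subfield K" "CARD('a) = (card K)\<^sup>2" "net_directions K m S" "d \<in> S"
    and "e \<notin> (\<lambda>k. d * k) ` K"
  shows "net_frame K S d e"
proof -
  note K = is_subfieldD[OF assms(1)]
  obtain D where D: "D \<subseteq> unit_cosets K" "S = \<Union>D"
    using assms(3) by (auto simp: net_directions_def)
  have S: "f \<noteq> 0" "(\<lambda>k. f * k) ` (K - {0}) \<in> D" if "f \<in> S" for f
    using Union_unit_cosets_memD[OF assms(1) D(1)] that D(2) by auto
  have indep: "u = 0 \<and> v = 0" if uv: "u \<in> K" "v \<in> K" "u * d + v * e = 0" for u v
  proof -
    have "v = 0"
    proof (rule ccontr)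
      assume "v \<noteq> 0"
      then have "e = d * (- u / v)"
        using uv(3) by (simp add: field_simps add_eq_0_iff)
      then show False
        using assms(5) K(5)[OF uv(1)] K(8) uv(2) by blast
    qed
    then show ?thesis
      using uv(3) S(1)[OF assms(4)] by simp
  qed
  \<comment> \<open>Spanning follows by counting: an injection from \<open>K \<times> K\<close> into
    a field with \<open>(card K)\<^sup>2\<close> elements is onto.\<close>
  have "inj_on (\<lambda>(u, v). u * d + v * e) (K \<times> K)"
  proof (rule inj_onI, clarify)
    fix u v u' v' assume *: "u \<in> K" "v \<in> K" "u' \<in> K" "v' \<in> K" "u * d + v * e = u' * d + v' * e"
    then have "(u - u') * d + (v - v') * e = 0" by (simp add: algebra_simps)
    then show "u = u' \<and> v = v'"
      using indep[of "u - u'" "v - v'"] * K(7) by auto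
  qed
  then have "card ((\<lambda>(u, v). u * d + v * e) ` (K \<times> K)) = CARD('a)"
    by (simp add: card_image card_cartesian_product assms(2) power2_eq_square)
  then have span: "(\<lambda>(u, v). u * d + v * e) ` (K \<times> K) = UNIV"
    by (intro card_subset_eq) auto
  show ?thesis
  proof
    fix f k assume "f \<in> S" "k \<in> K" "k \<noteq> 0"
    then have "f * k \<in> S"
      using S(2)[of f] D(2) by blast
    then show "k * f \<in> S"
      by (simp add: mult.commute)
  next
    fix z :: 'a
    have "z \<in> (\<lambda>(u, v). u * d + v * e) ` (K \<times> K)"
      by (simp add: span)
    then show "\<exists>u\<in>K. \<exists>v\<in>K. z = u * d + v * e"
      by auto
  qed (use assms S(1) indep in auto)
qed

theorem theorem3:
  fixes p n r m :: nat
    and K S L :: "'a::{field, finite} set"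
    and x :: 'a
  assumes "prime p" and "n \<ge> 1" and "r = p ^ n"
    and "CARD('a) = r ^ 2"
    and "is_subfield K" and "card K = r"
    and "m \<ge> 1" and "net_directions K m S"
    and "L \<in> net_lines K S" and "x \<notin> L"
  shows "clique (point_line_clique (collinearity_edges S) x L) (collinearity_edges S) \<and>
    (\<exists>!C. maximal_clique C (collinearity_edges S) \<and>
          point_line_clique (collinearity_edges S) x L \<subseteq> C) \<and>
    (\<not> p dvd (m - 1) \<longrightarrow>
     \<not> maximal_clique (point_line_clique (collinearity_edges S) x L) (collinearity_edges S) \<longrightarrow>
     (\<forall>C. maximal_clique C (collinearity_edges S) \<and>
          point_line_clique (collinearity_edges S) x L \<subseteq> C \<longrightarrow>
          (\<exists>!M. M \<in> net_lines K S \<and> x \<in> M \<and> C \<subseteq> L \<union> M)))"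
proof -
  obtain a d where ad: "d \<in> S" "L = (\<lambda>k. a + d * k) ` K"
    using assms(9) by (auto simp: net_lines_def)
  \<comment> \<open>Since \<open>x\<close> is not on \<open>L\<close>, the vector from
    \<open>x\<close> to the point \<open>a\<close> of \<open>L\<close> is not a
    \<open>K\<close>-multiple of \<open>d\<close> and can serve as second basis vector.\<close>
  have "a - x \<notin> (\<lambda>k. d * k) ` K"
  proof
    assume "a - x \<in> (\<lambda>k. d * k) ` K"
    then obtain k where "k \<in> K" "x = a + d * (- k)"
      by (auto simp: algebra_simps)
    then show False
      using ad(2) assms(10) is_subfieldD(5)[OF assms(5)] by blast
  qed
  then interpret net_frame K S x d "a - x"
    using assms ad by (intro net_frameI[where m = m]) auto
  have L: "L = (\<lambda>k. pt k 1) ` K"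
    unfolding ad(2) pt_def by (simp add: algebra_simps)
  have "card slopes = m - 1"
    using assms(8) card_slopes by (auto simp: net_directions_def)
  moreover have "CARD('a) = p ^ (n * 2)"
    using assms(3,4) by (simp add: power_mult)
  ultimately have n: "of_nat (card slopes) \<noteq> (0 :: 'a)" if "\<not> p dvd (m - 1)"
    using of_nat_eq_0_imp_prime_dvd[OF assms(1)] that by auto
  show ?thesis
    unfolding L point_line_clique_eq_base
  proof (intro conjI impI allI)
    show "clique base (collinearity_edges S)"
      by (rule clique_base)
    show "\<exists>!C. maximal_clique C (collinearity_edges S) \<and> base \<subseteq> C"
      using maximal_clique_hull base_subset_hull maximal_clique_eq_hull by blast
  next
    fix C
    assume "\<not> p dvd (m - 1)" "\<not> maximal_clique base (collinearity_edges S)"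
      and "maximal_clique C (collinearity_edges S) \<and> base \<subseteq> C"
    moreover from this have "C = hull"
      using maximal_clique_eq_hull by simp
    ultimately show "\<exists>!M. M \<in> net_lines K S \<and> x \<in> M \<and> C \<subseteq> (\<lambda>k. pt k 1) ` K \<union> M"
      using unique_line_covering_hull n by simp
  qed
qed

end
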